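(* Let $n_1,n_2>0$. For $\hat p\in[-1,1]$ and $z>0$ let $[L,U]=[L(\hat p,z),U(\hat p,z)]$ with $L=\min_{(p_1,p_2)\in\Omega_\square}(p_1-p_2)$ and $U=\max_{(p_1,p_2)\in\Omega_\square}(p_1-p_2)$ be the EO confidence interval. Then: (a) $L\le\hat p\le U$. (b) $[L,U]\subseteq[-1,1]$, and $[L,U]$ reaches an endpoint of $[-1,1]$ only in the cases $\hat p=1$ and $\hat p=-1$, in which $U=1$ and $L=-1$ respectively. (c) Both endpoints are attained by pairs $(p_1,p_2)\in\Omega_\square\subseteq[0,1]^2$, and every value in $[L,U]$ is the difference $p_1-p_2$ of some pair $(p_1,p_2)\in\Omega_\square$. (d) $L$ and $U$ are continuous functions of $(\hat p,z)$ on $[-1,1]\times(0,\infty)$, non-increasing and non-decreasing in $z$ respectively, and for each fixed $\hat p$ they satisfy $[L,U]\to\{\hat p\}$ as $z\downarrow0$ and $[L,U]\to[-1,1]$ as $z\to\infty$ (convergence of the endpoints).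
   Context: For $n_1,n_2,z>0$ and $\hat p\in[-1,1]$, $$\Omega_\square=\Omega_\square(\hat p;n_1,n_2,z)=\Bigl\{(p_1,p_2)\in[0,1]^2:(\hat p-p_1+p_2)^2\le z^2\Bigl(\tfrac{p_1(1-p_1)}{n_1}+\tfrac{p_2(1-p_2)}{n_2}\Bigr)\Bigr\}.$$ The interval between the minimum and the maximum of $p_1-p_2$ over $\Omega_\square$ is called the elliptically optimal (EO) confidence interval. *)

theory Defs
  imports "HOL-Analysis.Analysis"
begin

definition Omega_square :: "real \<Rightarrow> real \<Rightarrow> real \<Rightarrow> real \<Rightarrow> (real \<times> real) set" where
  "Omega_square n1 n2 p z =
     {(p1, p2). p1 \<in> {0..1} \<and> p2 \<in> {0..1} \<and>
        (p - p1 + p2)\<^sup>2 \<le> z\<^sup>2 * (p1 * (1 - p1) / n1 + p2 * (1 - p2) / n2)}"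

text \<open>
  \<open>LEAST\<close> and \<open>GREATEST\<close> on the reals denote the minimum and the maximum of a set
  and are unspecified if these do not exist; unlike \<open>Inf\<close> and \<open>Sup\<close>, they do not
  fall back to an unattained bound.
\<close>

definition EO_lower :: "real \<Rightarrow> real \<Rightarrow> real \<Rightarrow> real \<Rightarrow> real" where
  "EO_lower n1 n2 p z = (LEAST d. d \<in> (\<lambda>(p1, p2). p1 - p2) ` Omega_square n1 n2 p z)"

definition EO_upper :: "real \<Rightarrow> real \<Rightarrow> real \<Rightarrow> real \<Rightarrow> real" where
  "EO_upper n1 n2 p z = (GREATEST d. d \<in> (\<lambda>(p1, p2). p1 - p2) ` Omega_square n1 n2 p z)"

definition EO_interval :: "real \<Rightarrow> real \<Rightarrow> real \<Rightarrow> real \<Rightarrow> real set" where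
  "EO_interval n1 n2 p z = {EO_lower n1 n2 p z..EO_upper n1 n2 p z}"

end

theory Submission
  imports Defs
begin

text \<open>
  Call \<open>p - p1 + p2\<close> the bias of \<open>(p1, p2)\<close>, call \<open>p1 * (1 - p1) / n1 + p2 * (1 - p2) / n2\<close>
  its variance term, and call the difference of the two sides of the inequality defining
  \<open>\<Omega>\<^sub>\<box>\<close>, that is \<open>z\<^sup>2\<close> times the variance term minus the squared bias, its slack. For fixed
  \<open>p\<close> and \<open>z\<close> it is a concave quadratic polynomial in \<open>(p1, p2)\<close>, so \<open>\<Omega>\<^sub>\<box>\<close>
  is a compact convex set. It is nonempty, since it contains every point of the square with
  \<open>p1 - p2 = p\<close>. The differences \<open>p1 - p2\<close> over \<open>\<Omega>\<^sub>\<box>\<close> therefore fill a compact interval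
  containing \<open>p\<close>, which gives attainment and part (a); the difference \<open>1\<close> occurs only at the
  corner \<open>(1, 0)\<close>, where the variance term vanishes and the inequality forces \<open>p = 1\<close>.
  The point reflection of the square in its centre turns \<open>p\<close> into \<open>-p\<close> and
  exchanges the two endpoints up to sign, so the upper endpoint alone needs study.

  Continuity of the upper endpoint combines two semicontinuity arguments. If no point with
  difference at least \<open>c\<close> is feasible, then compactness of the square keeps this true for
  nearby parameters (\<open>closed_parameters_attaining\<close>). Conversely, some point has strictly positive
  slack, even for \<open>p = 1\<close> or \<open>p = -1\<close>: moving a point with \<open>p1 - p2 = p\<close> by a
  fraction \<open>t\<close> of the way to the centre creates variance of order \<open>t\<close> at the cost of a bias
  of order \<open>t\<close>, which enters only squared (\<open>exists_slack_pos\<close>). By concavity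
  the segment from a maximiser to such a point has positive slack away from the maximiser, so
  differences arbitrarily close to the maximum are attained with positive slack
  (\<open>slack_pos_near_upper\<close>) and survive small changes of \<open>p\<close> and \<open>z\<close>.

  The behaviour in \<open>z\<close> is elementary: \<open>\<Omega>\<^sub>\<box>\<close> grows with \<open>z\<close>, the bias
  of its points is at most a constant times \<open>z\<close>, and every interior point of the
  square belongs to it for large \<open>z\<close>.
\<close>

section \<open>The slack and its concavity\<close>

definition slack :: "real \<Rightarrow> real \<Rightarrow> real \<Rightarrow> real \<Rightarrow> real \<times> real \<Rightarrow> real" where
  "slack n1 n2 p z x =
     z\<^sup>2 * (fst x * (1 - fst x) / n1 + snd x * (1 - snd x) / n2) - (p - fst x + snd x)\<^sup>2"

lemma Omega_square_slack:
  "Omega_square n1 n2 p z = {x \<in> {0..1} \<times> {0..1}. 0 \<le> slack n1 n2 p z x}"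
  by (auto simp: Omega_square_def slack_def)

text \<open>The defect in Jensen's inequality is explicit, because the slack is quadratic.\<close>

lemma slack_concave:
  assumes "n1 > 0" "n2 > 0" "0 \<le> t" "t \<le> 1"
  shows "(1 - t) * slack n1 n2 p z x + t * slack n1 n2 p z y
           \<le> slack n1 n2 p z ((1 - t) *\<^sub>R x + t *\<^sub>R y)"
proof -
  define a b where "a = 1 / n1" and "b = 1 / n2"
  obtain x1 x2 y1 y2 where xy: "x = (x1, x2)" "y = (y1, y2)"
    by (metis surj_pair)
  have "slack n1 n2 p z ((1 - t) *\<^sub>R x + t *\<^sub>R y)
          - ((1 - t) * slack n1 n2 p z x + t * slack n1 n2 p z y)
        = t * (1 - t) * (z\<^sup>2 * (a * (x1 - y1)\<^sup>2 + b * (x2 - y2)\<^sup>2)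
                          + (x1 - y1 - (x2 - y2))\<^sup>2)"
    unfolding xy slack_def divide_inverse
    by (simp add: a_def b_def divide_inverse) algebra
  also have "\<dots> \<ge> 0"
    using assms by (simp add: a_def b_def)
  finally show ?thesis by simp
qed

lemma convex_Omega_square:
  assumes "n1 > 0" "n2 > 0"
  shows "convex (Omega_square n1 n2 p z)"
  unfolding convex_alt
proof (intro ballI allI impI)
  fix x y t
  assume x: "x \<in> Omega_square n1 n2 p z" and y: "y \<in> Omega_square n1 n2 p z"
    and t: "0 \<le> (t::real) \<and> t \<le> 1"
  have "0 \<le> (1 - t) * slack n1 n2 p z x + t * slack n1 n2 p z y"
    using x y t by (simp add: Omega_square_slack)
  also have "\<dots> \<le> slack n1 n2 p z ((1 - t) *\<^sub>R x + t *\<^sub>R y)"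
    using assms t by (intro slack_concave) auto
  finally have "0 \<le> slack n1 n2 p z ((1 - t) *\<^sub>R x + t *\<^sub>R y)" .
  moreover have "(1 - t) *\<^sub>R x + t *\<^sub>R y \<in> {0..1} \<times> {0..1}"
  proof (rule convexD_alt)
    show "convex ({0..1} \<times> {0..1} :: (real \<times> real) set)"
      by (intro convex_Times convex_real_interval)
  qed (use x y t in \<open>auto simp: Omega_square_slack\<close>)
  ultimately show "(1 - t) *\<^sub>R x + t *\<^sub>R y \<in> Omega_square n1 n2 p z"
    by (simp add: Omega_square_slack)
qed

lemma continuous_on_slack:
  "continuous_on S (\<lambda>(x, p, z). slack n1 n2 p z x)"
  unfolding slack_def split_beta divide_inverse by (intro continuous_intros)

lemma compact_Omega_square: "compact (Omega_square n1 n2 p z)"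
proof -
  have "continuous_on UNIV (slack n1 n2 p z)"
    unfolding slack_def divide_inverse by (intro continuous_intros)
  then have "closed {x. 0 \<le> slack n1 n2 p z x}"
    by (intro closed_Collect_le) auto
  then have "compact (({0..1} \<times> {0..1}) \<inter> {x. 0 \<le> slack n1 n2 p z x})"
    by (intro compact_Int_closed compact_Times) auto
  moreover have "Omega_square n1 n2 p z = ({0..1} \<times> {0..1}) \<inter> {x. 0 \<le> slack n1 n2 p z x}"
    unfolding Omega_square_slack by blast
  ultimately show ?thesis by simp
qed

text \<open>
  The points \<open>(p, 0)\<close> and \<open>(0, -p)\<close>, according to the sign of \<open>p\<close>, lie in the square
  and have zero bias.
\<close>

lemma exists_unbiased:
  assumes "n1 > 0" "n2 > 0" "p \<in> {-1..1}"
  shows "\<exists>x\<in>Omega_square n1 n2 p z. fst x - snd x = p"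
proof
  show "(max p 0, max (-p) 0) \<in> Omega_square n1 n2 p z"
  proof -
    have "0 \<le> z\<^sup>2 * (max p 0 * (1 - max p 0) / n1 + max (-p) 0 * (1 - max (-p) 0) / n2)"
      using assms
      by (intro mult_nonneg_nonneg add_nonneg_nonneg divide_nonneg_nonneg) auto
    moreover have "p - max p 0 + max (-p) 0 = 0" by simp
    ultimately show ?thesis using assms by (simp add: Omega_square_def)
  qed
qed auto

text \<open>
  The witness is the point with difference \<open>p\<close> on an edge of the square, moved by the fraction
  \<open>t\<close> towards the centre: its variance term is at least \<open>t * (1 / n1 + 1 / n2) / 4\<close>
  and its bias is \<open>t * p\<close>.
\<close>

lemma exists_slack_pos:
  assumes n: "n1 > 0" "n2 > 0" and p: "p \<in> {-1..1}" and z: "z > 0"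
  shows "\<exists>x\<in>{0..1} \<times> {0..1}. 0 < slack n1 n2 p z x"
proof -
  define C where "C = 1 / n1 + 1 / n2"
  have C: "C > 0" using n by (simp add: C_def add_pos_pos)
  \<comment> \<open>Any \<open>t < z\<^sup>2 * C / 4\<close> works: the squared bias \<open>t\<^sup>2 * p\<^sup>2\<close> is then below \<open>t * (z\<^sup>2 * C / 4)\<close>.\<close>
  define t where "t = min 1 (z\<^sup>2 * C / 8)"
  have t: "0 < t" "t \<le> 1" "t < z\<^sup>2 * C / 4"
    using C z by (auto simp: t_def min_def)
  define u v where "u = (1 - t) * max p 0 + t / 2" and "v = (1 - t) * max (-p) 0 + t / 2"
  have variance: "t / 4 \<le> w * (1 - w)" "0 \<le> w" "w \<le> 1"
    if "w = (1 - t) * a + t / 2" "0 \<le> a" "a \<le> 1" for w a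
  proof -
    have "w * (1 - w) = (1 - t)\<^sup>2 * (a * (1 - a)) + t / 4 + t * (1 - t) / 4"
      unfolding that by (simp add: power2_eq_square field_simps)
    moreover have "0 \<le> (1 - t)\<^sup>2 * (a * (1 - a))" "0 \<le> t * (1 - t) / 4"
      using that t by auto
    ultimately show "t / 4 \<le> w * (1 - w)" by linarith
    show "0 \<le> w" using that t by simp
    have "(1 - t) * a \<le> (1 - t) * 1"
      using that t by (intro mult_left_mono) auto
    then show "w \<le> 1" using that t by simp
  qed
  have u: "t / 4 \<le> u * (1 - u)" "0 \<le> u" "u \<le> 1"
    using variance[OF u_def] p by auto
  have v: "t / 4 \<le> v * (1 - v)" "0 \<le> v" "v \<le> 1"
    using variance[OF v_def] p by auto
  have "p - u + v = t * p"
    by (simp add: u_def v_def max_def algebra_simps)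
  then have "(p - u + v)\<^sup>2 = t * (t * p\<^sup>2)"
    by (simp add: power2_eq_square)
  also have "\<dots> \<le> t * (t * 1)"
    using t p by (intro mult_left_mono) (auto simp: abs_square_le_1 abs_le_iff)
  also have "\<dots> < t * (z\<^sup>2 * C / 4)"
    using t by simp
  also have "\<dots> = z\<^sup>2 * ((t / 4) / n1 + (t / 4) / n2)"
    by (simp add: C_def field_simps)
  also have "\<dots> \<le> z\<^sup>2 * (u * (1 - u) / n1 + v * (1 - v) / n2)"
    using u v n by (intro mult_left_mono add_mono divide_right_mono) auto
  finally have "0 < slack n1 n2 p z (u, v)"
    by (simp add: slack_def)
  then show ?thesis using u v by (intro bexI[of _ "(u, v)"]) auto
qed

section \<open>The endpoints as attained extrema\<close>

lemma EO_upper_attained: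
  assumes "n1 > 0" "n2 > 0" "p \<in> {-1..1}"
  shows "\<exists>x\<in>Omega_square n1 n2 p z. fst x - snd x = EO_upper n1 n2 p z"
    and "x \<in> Omega_square n1 n2 p z \<Longrightarrow> fst x - snd x \<le> EO_upper n1 n2 p z"
proof -
  have "Omega_square n1 n2 p z \<noteq> {}"
    using exists_unbiased[OF assms, of z] by auto
  moreover have "continuous_on (Omega_square n1 n2 p z) (\<lambda>x. fst x - snd x)"
    by (intro continuous_intros)
  ultimately have "\<exists>m\<in>Omega_square n1 n2 p z. \<forall>x\<in>Omega_square n1 n2 p z.
      fst x - snd x \<le> fst m - snd m"
    by (intro continuous_attains_sup compact_Omega_square)
  then obtain m where m: "m \<in> Omega_square n1 n2 p z"
      "\<And>x. x \<in> Omega_square n1 n2 p z \<Longrightarrow> fst x - snd x \<le> fst m - snd m"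
    by blast
  have upper: "EO_upper n1 n2 p z = fst m - snd m"
    unfolding EO_upper_def
  proof (rule Greatest_equality)
    show "fst m - snd m \<in> (\<lambda>(p1, p2). p1 - p2) ` Omega_square n1 n2 p z"
      using m(1) unfolding split_beta by (rule imageI)
    show "d \<le> fst m - snd m" if "d \<in> (\<lambda>(p1, p2). p1 - p2) ` Omega_square n1 n2 p z" for d
      using that m(2) by (force simp: split_beta)
  qed
  with m(1) show "\<exists>x\<in>Omega_square n1 n2 p z. fst x - snd x = EO_upper n1 n2 p z"
    by (intro bexI[of _ m]) simp
  show "x \<in> Omega_square n1 n2 p z \<Longrightarrow> fst x - snd x \<le> EO_upper n1 n2 p z"
    using m(2) upper by simp
qed

lemma reflection_Omega_square:
  "(1 - fst x, 1 - snd x) \<in> Omega_square n1 n2 (-p) z \<longleftrightarrow> x \<in> Omega_square n1 n2 p z"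
proof -
  have "(-p - (1 - fst x) + (1 - snd x))\<^sup>2 = (p - fst x + snd x)\<^sup>2"
    by (simp add: power2_eq_square algebra_simps)
  then show ?thesis
    by (cases x) (auto simp: Omega_square_def mult.commute)
qed

text \<open>
  The reflection \<open>x \<mapsto> (1 - fst x, 1 - snd x)\<close> preserves the variance term and negates the
  difference.
\<close>

lemma EO_lower_eq_uminus_EO_upper:
  assumes "n1 > 0" "n2 > 0" "p \<in> {-1..1}"
  shows "EO_lower n1 n2 p z = - EO_upper n1 n2 (-p) z"
  unfolding EO_lower_def
proof (rule Least_equality)
  have p: "-p \<in> {-1..1}" using assms by auto
  obtain m where m: "m \<in> Omega_square n1 n2 (-p) z" "fst m - snd m = EO_upper n1 n2 (-p) z"
    using EO_upper_attained(1)[OF assms(1,2) p] by blast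
  have "(1 - fst m, 1 - snd m) \<in> Omega_square n1 n2 p z"
    using m(1) reflection_Omega_square[of m n1 n2 "-p" z] by simp
  then show "- EO_upper n1 n2 (-p) z \<in> (\<lambda>(p1, p2). p1 - p2) ` Omega_square n1 n2 p z"
    using m(2) by (intro image_eqI) auto
  fix d assume "d \<in> (\<lambda>(p1, p2). p1 - p2) ` Omega_square n1 n2 p z"
  then obtain x where x: "x \<in> Omega_square n1 n2 p z" "d = fst x - snd x"
    by (auto simp: split_beta)
  then show "- EO_upper n1 n2 (-p) z \<le> d"
    using EO_upper_attained(2)[OF assms(1,2) p, of "(1 - fst x, 1 - snd x)" z]
    by (simp add: reflection_Omega_square)
qed

lemma EO_lower_attained:
  assumes "n1 > 0" "n2 > 0" "p \<in> {-1..1}"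
  shows "\<exists>x\<in>Omega_square n1 n2 p z. fst x - snd x = EO_lower n1 n2 p z"
    and "x \<in> Omega_square n1 n2 p z \<Longrightarrow> EO_lower n1 n2 p z \<le> fst x - snd x"
proof -
  have p: "-p \<in> {-1..1}" using assms by auto
  obtain m where m: "m \<in> Omega_square n1 n2 (-p) z" "fst m - snd m = EO_upper n1 n2 (-p) z"
    using EO_upper_attained(1)[OF assms(1,2) p] by blast
  show "\<exists>x\<in>Omega_square n1 n2 p z. fst x - snd x = EO_lower n1 n2 p z"
    using m reflection_Omega_square[of m n1 n2 "-p" z]
    by (intro bexI[of _ "(1 - fst m, 1 - snd m)"])
       (auto simp: EO_lower_eq_uminus_EO_upper[OF assms])
  show "x \<in> Omega_square n1 n2 p z \<Longrightarrow> EO_lower n1 n2 p z \<le> fst x - snd x"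
    using EO_upper_attained(2)[OF assms(1,2) p, of "(1 - fst x, 1 - snd x)" z]
    by (simp add: reflection_Omega_square EO_lower_eq_uminus_EO_upper[OF assms])
qed

lemma EO_interval_eq_differences:
  assumes "n1 > 0" "n2 > 0" "p \<in> {-1..1}"
  shows "EO_interval n1 n2 p z = (\<lambda>x. fst x - snd x) ` Omega_square n1 n2 p z"
proof
  have "linear (\<lambda>x::real \<times> real. fst x - snd x)"
    by (intro linear_compose_sub linear_fst linear_snd)
  then have "is_interval ((\<lambda>x. fst x - snd x) ` Omega_square n1 n2 p z)"
    using convex_Omega_square[OF assms(1,2)] convex_linear_image is_interval_convex_1 by blast
  moreover have "EO_lower n1 n2 p z \<in> (\<lambda>x. fst x - snd x) ` Omega_square n1 n2 p z"
    using EO_lower_attained(1)[OF assms, of z] by (blast intro: sym rev_image_eqI)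
  moreover have "EO_upper n1 n2 p z \<in> (\<lambda>x. fst x - snd x) ` Omega_square n1 n2 p z"
    using EO_upper_attained(1)[OF assms, of z] by (blast intro: sym rev_image_eqI)
  ultimately show "EO_interval n1 n2 p z \<subseteq> (\<lambda>x. fst x - snd x) ` Omega_square n1 n2 p z"
    unfolding EO_interval_def by (auto intro: mem_is_interval_1_I)
  show "(\<lambda>x. fst x - snd x) ` Omega_square n1 n2 p z \<subseteq> EO_interval n1 n2 p z"
    using EO_lower_attained(2)[OF assms] EO_upper_attained(2)[OF assms]
    by (auto simp: EO_interval_def)
qed

lemma EO_upper_ge:
  assumes "n1 > 0" "n2 > 0" "p \<in> {-1..1}"
  shows "p \<le> EO_upper n1 n2 p z"
  using exists_unbiased[OF assms, of z] EO_upper_attained(2)[OF assms, of _ z] by metis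

lemma EO_lower_le:
  assumes "n1 > 0" "n2 > 0" "p \<in> {-1..1}"
  shows "EO_lower n1 n2 p z \<le> p"
  using exists_unbiased[OF assms, of z] EO_lower_attained(2)[OF assms, of _ z] by metis

lemma EO_upper_le_1:
  assumes "n1 > 0" "n2 > 0" "p \<in> {-1..1}"
  shows "EO_upper n1 n2 p z \<le> 1"
  using EO_upper_attained(1)[OF assms, of z] by (auto simp: Omega_square_def)

lemma EO_lower_ge_minus_1:
  assumes "n1 > 0" "n2 > 0" "p \<in> {-1..1}"
  shows "-1 \<le> EO_lower n1 n2 p z"
  using EO_lower_attained(1)[OF assms, of z] by (auto simp: Omega_square_def)

text \<open>
  A difference of \<open>1\<close> in the square occurs only at the corner \<open>(1, 0)\<close>, whose variance term
  is zero.
\<close>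

lemma one_in_EO_interval:
  assumes "n1 > 0" "n2 > 0" "p \<in> {-1..1}" "1 \<in> EO_interval n1 n2 p z"
  shows "p = 1"
proof -
  obtain a b where ab: "(a, b) \<in> Omega_square n1 n2 p z" "a - b = 1"
    using assms(4) unfolding EO_interval_eq_differences[OF assms(1-3)] by auto
  then have "a = 1" "b = 0" by (auto simp: Omega_square_def)
  with ab show "p = 1" by (simp add: Omega_square_def)
qed

lemma minus_one_in_EO_interval:
  assumes "n1 > 0" "n2 > 0" "p \<in> {-1..1}" "-1 \<in> EO_interval n1 n2 p z"
  shows "p = -1"
proof -
  obtain a b where ab: "(a, b) \<in> Omega_square n1 n2 p z" "a - b = -1"
    using assms(4) unfolding EO_interval_eq_differences[OF assms(1-3)] by fastforce
  then have "a = 0" "b = 1" by (auto simp: Omega_square_def)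
  with ab show "p = -1" by (simp add: Omega_square_def)
qed

section \<open>Continuity in the parameters\<close>

text \<open>
  Upper semicontinuity of the maximum: projecting the closed set of feasible triples
  \<open>(x, p, z)\<close> along the compact square yields a closed set of parameters.
\<close>

lemma closed_parameters_attaining:
  "closed {(p, z). \<exists>x\<in>Omega_square n1 n2 p z. c \<le> fst x - snd x}"
proof -
  have "continuous_on UNIV (\<lambda>(x, p, z). slack n1 n2 p z x)"
    by (rule continuous_on_slack)
  then have "closed {w. 0 \<le> (\<lambda>(x, p, z). slack n1 n2 p z x) w}"
    by (intro closed_Collect_le) auto
  moreover have "closed {w::(real \<times> real) \<times> (real \<times> real). c \<le> fst (fst w) - snd (fst w)}"
    by (intro closed_Collect_le continuous_intros)
  ultimately have "closed ({w. 0 \<le> (\<lambda>(x, p, z). slack n1 n2 p z x) w}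
      \<inter> {w. c \<le> fst (fst w) - snd (fst w)})"
    by (rule closed_Int)
  moreover have "compact ({0..1} \<times> {0..1} :: (real \<times> real) set)"
    by (intro compact_Times) auto
  ultimately have "closed {y. \<exists>x. x \<in> {0..1} \<times> {0..1} \<and> (x, y) \<in>
      {w. 0 \<le> (\<lambda>(x, p, z). slack n1 n2 p z x) w} \<inter> {w. c \<le> fst (fst w) - snd (fst w)}}"
    by (intro closed_compact_projection)
  then show ?thesis
    by (rule back_subst[of closed]) (auto simp: Omega_square_slack)
qed

lemma slack_pos_near_upper:
  assumes n: "n1 > 0" "n2 > 0" and p: "p \<in> {-1..1}" and z: "z > 0"
    and c: "c < EO_upper n1 n2 p z"
  shows "\<exists>x\<in>{0..1} \<times> {0..1}. 0 < slack n1 n2 p z x \<and> c < fst x - snd x"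
proof -
  obtain m where m: "m \<in> Omega_square n1 n2 p z" "fst m - snd m = EO_upper n1 n2 p z"
    using EO_upper_attained(1)[OF n p] by blast
  obtain s where s: "s \<in> {0..1} \<times> {0..1}" "0 < slack n1 n2 p z s"
    using exists_slack_pos[OF n p z] by blast
  define y where "y t = (1 - t) *\<^sub>R m + t *\<^sub>R s" for t :: real
  have "((\<lambda>t. fst (y t) - snd (y t)) \<longlongrightarrow> fst (y 0) - snd (y 0)) (at_right 0)"
    unfolding y_def by (intro tendsto_intros)
  then have "\<forall>\<^sub>F t in at_right 0. c < fst (y t) - snd (y t)"
    by (rule order_tendstoD) (simp add: y_def m c)
  moreover have "\<forall>\<^sub>F t in at_right 0. t \<in> {0<..<1::real}"
    by (rule eventually_at_right_real) simp
  ultimately have "\<forall>\<^sub>F t in at_right 0. c < fst (y t) - snd (y t) \<and> t \<in> {0<..<1::real}"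
    by (rule eventually_conj)
  then obtain t where t: "c < fst (y t) - snd (y t)" "0 < t" "t < 1"
    using eventually_happens'[OF trivial_limit_at_right_real] by fastforce
  have "0 < (1 - t) * slack n1 n2 p z m + t * slack n1 n2 p z s"
    using m s t by (intro add_nonneg_pos mult_nonneg_nonneg mult_pos_pos)
      (auto simp: Omega_square_slack)
  also have "\<dots> \<le> slack n1 n2 p z (y t)"
    unfolding y_def using n t by (intro slack_concave) auto
  finally have "0 < slack n1 n2 p z (y t)" .
  moreover have "y t \<in> {0..1} \<times> {0..1}"
    unfolding y_def
  proof (rule convexD_alt)
    show "convex ({0..1} \<times> {0..1} :: (real \<times> real) set)"
      by (intro convex_Times convex_real_interval)
  qed (use m s t in \<open>auto simp: Omega_square_slack\<close>)
  ultimately show ?thesis using t(1) by (intro bexI[of _ "y t"] conjI)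
qed

lemma continuous_on_EO_upper:
  assumes n: "n1 > 0" "n2 > 0"
  shows "continuous_on ({-1..1} \<times> {0<..}) (\<lambda>(p, z). EO_upper n1 n2 p z)"
  unfolding continuous_on_def
proof
  let ?D = "{-1..1} \<times> {0<..} :: (real \<times> real) set"
  fix w assume w: "w \<in> ?D"
  then obtain p z where pz: "w = (p, z)" "p \<in> {-1..1}" "z > 0" by auto
  have D: "\<forall>\<^sub>F w' in at w within ?D. w' \<in> ?D"
    by (simp add: eventually_at_filter)
  show "((\<lambda>(p, z). EO_upper n1 n2 p z) \<longlongrightarrow> (\<lambda>(p, z). EO_upper n1 n2 p z) w) (at w within ?D)"
  proof (rule order_tendstoI)
    fix c assume "c < (\<lambda>(p, z). EO_upper n1 n2 p z) w"
    then have "c < EO_upper n1 n2 p z" using pz(1) by simp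
    then obtain x where x: "x \<in> {0..1} \<times> {0..1}" "0 < slack n1 n2 p z x" "c < fst x - snd x"
      using slack_pos_near_upper[OF n pz(2,3)] by blast
    have "((\<lambda>w. slack n1 n2 (fst w) (snd w) x) \<longlongrightarrow> slack n1 n2 (fst w) (snd w) x) (at w within ?D)"
      unfolding slack_def by (intro tendsto_intros)
    then have "\<forall>\<^sub>F w' in at w within ?D. 0 < slack n1 n2 (fst w') (snd w') x"
      using x(2) pz(1) by (intro order_tendstoD) auto
    with D show "\<forall>\<^sub>F w' in at w within ?D. c < (\<lambda>(p, z). EO_upper n1 n2 p z) w'"
    proof eventually_elim
      case (elim w')
      then have "x \<in> Omega_square n1 n2 (fst w') (snd w')"
        using x(1) by (simp add: Omega_square_slack)
      then have "fst x - snd x \<le> EO_upper n1 n2 (fst w') (snd w')"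
        using elim(1) by (intro EO_upper_attained(2)[OF n]) auto
      then show ?case using x(3) by (simp add: split_beta)
    qed
  next
    fix c assume c: "(\<lambda>(p, z). EO_upper n1 n2 p z) w < c"
    let ?K = "{(p, z). \<exists>x\<in>Omega_square n1 n2 p z. c \<le> fst x - snd x}"
    have "w \<notin> ?K"
      using c pz EO_upper_attained(2)[OF n pz(2), of _ z] by fastforce
    then have "\<forall>\<^sub>F w' in nhds w. w' \<in> - ?K"
      using closed_parameters_attaining[of n1 n2 c]
      by (intro eventually_nhds_in_open) (auto simp: open_Compl)
    then have "\<forall>\<^sub>F w' in at w within ?D. w' \<in> - ?K"
      by (auto simp: eventually_at_filter elim: eventually_mono)
    with D show "\<forall>\<^sub>F w' in at w within ?D. (\<lambda>(p, z). EO_upper n1 n2 p z) w' < c"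
    proof eventually_elim
      case (elim w')
      obtain m where "m \<in> Omega_square n1 n2 (fst w') (snd w')"
          "fst m - snd m = EO_upper n1 n2 (fst w') (snd w')"
        using EO_upper_attained(1)[OF n, of "fst w'" "snd w'"] elim(1) by auto
      moreover from this(1) have "\<not> c \<le> fst m - snd m"
        using elim(2) by (auto simp: split_beta)
      ultimately show ?case by (simp add: split_beta)
    qed
  qed
qed

lemma continuous_on_EO_lower:
  assumes n: "n1 > 0" "n2 > 0"
  shows "continuous_on ({-1..1} \<times> {0<..}) (\<lambda>(p, z). EO_lower n1 n2 p z)"
proof -
  let ?D = "{-1..1} \<times> {0<..} :: (real \<times> real) set"
  have "continuous_on ?D (\<lambda>w. (\<lambda>(p, z). EO_upper n1 n2 p z) (- fst w, snd w))"
    by (rule continuous_on_compose2[OF continuous_on_EO_upper[OF n]])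
       (auto intro!: continuous_on_Pair continuous_on_minus continuous_on_fst continuous_on_snd
          continuous_on_id)
  then have "continuous_on ?D (\<lambda>w. - EO_upper n1 n2 (- fst w) (snd w))"
    by (auto intro: continuous_on_minus)
  then show ?thesis
    by (rule continuous_on_eq) (auto simp: EO_lower_eq_uminus_EO_upper n)
qed

section \<open>Monotonicity and limits in \<open>z\<close>\<close>

lemma Omega_square_mono:
  assumes "n1 > 0" "n2 > 0" "0 \<le> z" "z \<le> z'"
  shows "Omega_square n1 n2 p z \<subseteq> Omega_square n1 n2 p z'"
proof
  fix x assume "x \<in> Omega_square n1 n2 p z"
  then obtain a b where x: "x = (a, b)" "a \<in> {0..1}" "b \<in> {0..1}"
    "(p - a + b)\<^sup>2 \<le> z\<^sup>2 * (a * (1 - a) / n1 + b * (1 - b) / n2)"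
    by (auto simp: Omega_square_def)
  note x(4)
  also have "z\<^sup>2 * (a * (1 - a) / n1 + b * (1 - b) / n2)
      \<le> z'\<^sup>2 * (a * (1 - a) / n1 + b * (1 - b) / n2)"
    using assms x by (intro mult_right_mono power_mono add_nonneg_nonneg) auto
  finally show "x \<in> Omega_square n1 n2 p z'"
    using x by (simp add: Omega_square_def)
qed

lemma EO_upper_mono:
  assumes "n1 > 0" "n2 > 0" "p \<in> {-1..1}" "0 \<le> z" "z \<le> z'"
  shows "EO_upper n1 n2 p z \<le> EO_upper n1 n2 p z'"
  using EO_upper_attained(1)[OF assms(1-3), of z] EO_upper_attained(2)[OF assms(1-3), of _ z']
    Omega_square_mono[OF assms(1,2,4,5), of p] by (metis subsetD)

text \<open>On the square the variance term is at most \<open>1 / n1 + 1 / n2\<close>, which bounds the bias.\<close>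

lemma EO_upper_le_linear:
  assumes n: "n1 > 0" "n2 > 0" and p: "p \<in> {-1..1}" and z: "z > 0"
  shows "EO_upper n1 n2 p z \<le> p + z * sqrt (1 / n1 + 1 / n2)"
proof -
  obtain x where "x \<in> Omega_square n1 n2 p z" "fst x - snd x = EO_upper n1 n2 p z"
    using EO_upper_attained(1)[OF n p] by blast
  then obtain a b where ab: "a \<in> {0..1}" "b \<in> {0..1}" "a - b = EO_upper n1 n2 p z"
    "(p - a + b)\<^sup>2 \<le> z\<^sup>2 * (a * (1 - a) / n1 + b * (1 - b) / n2)"
    by (cases x) (auto simp: Omega_square_def)
  have "a * (1 - a) \<le> 1" "b * (1 - b) \<le> 1"
    using ab by (auto intro: mult_le_one)
  then have "z\<^sup>2 * (a * (1 - a) / n1 + b * (1 - b) / n2) \<le> z\<^sup>2 * (1 / n1 + 1 / n2)"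
    using n by (intro mult_left_mono add_mono divide_right_mono) auto
  with ab(4) have "(p - a + b)\<^sup>2 \<le> z\<^sup>2 * (1 / n1 + 1 / n2)"
    by linarith
  also have "\<dots> = (z * sqrt (1 / n1 + 1 / n2))\<^sup>2"
    using n by (simp add: power_mult_distrib)
  finally have "\<bar>p - a + b\<bar> \<le> z * sqrt (1 / n1 + 1 / n2)"
    using n z by (auto simp: abs_le_square_iff[symmetric])
  then show ?thesis using ab(3) by linarith
qed

lemma EO_upper_tendsto_at_right_0:
  assumes n: "n1 > 0" "n2 > 0" and p: "p \<in> {-1..1}"
  shows "(EO_upper n1 n2 p \<longlongrightarrow> p) (at_right 0)"
proof (rule tendsto_sandwich[where f = "\<lambda>_. p"])
  have "((\<lambda>z. p + z * sqrt (1 / n1 + 1 / n2)) \<longlongrightarrow> p + 0 * sqrt (1 / n1 + 1 / n2)) (at_right 0)"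
    by (intro tendsto_intros)
  then show "((\<lambda>z. p + z * sqrt (1 / n1 + 1 / n2)) \<longlongrightarrow> p) (at_right 0)"
    by simp
  show "\<forall>\<^sub>F z in at_right 0. EO_upper n1 n2 p z \<le> p + z * sqrt (1 / n1 + 1 / n2)"
    using EO_upper_le_linear[OF n p] by (auto simp: eventually_at_filter)
  show "\<forall>\<^sub>F z in at_right 0. p \<le> EO_upper n1 n2 p z"
    using EO_upper_ge[OF n p] by (intro always_eventually allI)
qed simp

text \<open>
  For \<open>0 < e < 1/2\<close> the interior point \<open>(1 - e, e)\<close> has difference \<open>1 - 2 * e\<close> and
  squared bias at most \<open>4\<close>, so it is feasible once \<open>z\<close> is large.
\<close>

lemma EO_upper_tendsto_at_top:
  assumes n: "n1 > 0" "n2 > 0" and p: "p \<in> {-1..1}"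
  shows "(EO_upper n1 n2 p \<longlongrightarrow> 1) at_top"
proof (rule order_tendstoI)
  fix c :: real assume "1 < c"
  then have "EO_upper n1 n2 p z < c" for z
    using EO_upper_le_1[OF n p, of z] by linarith
  then show "\<forall>\<^sub>F z in at_top. EO_upper n1 n2 p z < c" by simp
next
  fix c :: real assume c: "c < 1"
  define e where "e = min (1 / 4) ((1 - c) / 4)"
  have e: "0 < e" "e \<le> 1 / 4" "c < 1 - 2 * e"
    using c by (auto simp: e_def min_def field_simps)
  define k where "k = e * (1 - e) / n1 + e * (1 - e) / n2"
  have k: "k > 0" using e n by (simp add: k_def add_pos_pos)
  show "\<forall>\<^sub>F z in at_top. c < EO_upper n1 n2 p z"
    \<comment> \<open>The bound \<open>z \<ge> 4 / k\<close> gives \<open>4 \<le> z * k\<close>, and \<open>z \<ge> 1\<close> gives \<open>z \<le> z\<^sup>2\<close>.\<close>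
    using eventually_ge_at_top[of "max 1 (4 / k)"]
  proof eventually_elim
    case (elim z)
    have "(p - (1 - e) + e)\<^sup>2 \<le> 2\<^sup>2"
      using p e by (intro power2_le_iff_abs_le[THEN iffD2]) auto
    also have "\<dots> \<le> z * k" using elim k by (simp add: field_simps)
    also have "\<dots> \<le> z\<^sup>2 * k"
      using elim k by (intro mult_right_mono) (auto simp: power2_eq_square)
    finally have "(1 - e, e) \<in> Omega_square n1 n2 p z"
      using e by (simp add: Omega_square_def k_def mult.commute)
    from EO_upper_attained(2)[OF n p this] show ?case using e by simp
  qed
qed

theorem corollary4:
  fixes n1 n2 :: real
  assumes "n1 > 0" and "n2 > 0"
  shows
    "(\<forall>p\<in>{-1..1}. \<forall>z>0. EO_lower n1 n2 p z \<le> p \<and> p \<le> EO_upper n1 n2 p z)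
   \<and> (\<forall>p\<in>{-1..1}. \<forall>z>0.
        EO_interval n1 n2 p z \<subseteq> {-1..1}
      \<and> (1 \<in> EO_interval n1 n2 p z \<longrightarrow> p = 1)
      \<and> (-1 \<in> EO_interval n1 n2 p z \<longrightarrow> p = -1)
      \<and> (p = 1 \<longrightarrow> EO_upper n1 n2 p z = 1)
      \<and> (p = -1 \<longrightarrow> EO_lower n1 n2 p z = -1))
   \<and> (\<forall>p\<in>{-1..1}. \<forall>z>0.
        Omega_square n1 n2 p z \<subseteq> {0..1} \<times> {0..1}
      \<and> (\<forall>(p1, p2)\<in>Omega_square n1 n2 p z. p1 - p2 \<in> EO_interval n1 n2 p z)
      \<and> (\<exists>(p1, p2)\<in>Omega_square n1 n2 p z. p1 - p2 = EO_lower n1 n2 p z)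
      \<and> (\<exists>(p1, p2)\<in>Omega_square n1 n2 p z. p1 - p2 = EO_upper n1 n2 p z)
      \<and> (\<forall>d\<in>EO_interval n1 n2 p z. \<exists>(p1, p2)\<in>Omega_square n1 n2 p z. p1 - p2 = d))
   \<and> (continuous_on ({-1..1} \<times> {0<..}) (\<lambda>(p, z). EO_lower n1 n2 p z)
      \<and> continuous_on ({-1..1} \<times> {0<..}) (\<lambda>(p, z). EO_upper n1 n2 p z)
      \<and> (\<forall>p\<in>{-1..1}.
           antimono_on {0<..} (EO_lower n1 n2 p)
         \<and> mono_on {0<..} (EO_upper n1 n2 p)
         \<and> (EO_lower n1 n2 p \<longlongrightarrow> p) (at_right 0)
         \<and> (EO_upper n1 n2 p \<longlongrightarrow> p) (at_right 0)
         \<and> (EO_lower n1 n2 p \<longlongrightarrow> -1) at_top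
         \<and> (EO_upper n1 n2 p \<longlongrightarrow> 1) at_top))"
proof (intro conjI ballI allI impI)
  note n = assms
  let ?D = "{-1..1} \<times> {0<..} :: (real \<times> real) set"
  show "continuous_on ?D (\<lambda>(p, z). EO_lower n1 n2 p z)"
    by (rule continuous_on_EO_lower[OF n])
  show "continuous_on ?D (\<lambda>(p, z). EO_upper n1 n2 p z)"
    by (rule continuous_on_EO_upper[OF n])
  fix p :: real assume p: "p \<in> {-1..1}"
  then have p_minus: "-p \<in> {-1..1}" by auto
  have lower: "EO_lower n1 n2 p = (\<lambda>z. - EO_upper n1 n2 (-p) z)"
    using EO_lower_eq_uminus_EO_upper[OF n p] by auto
  show "mono_on {0<..} (EO_upper n1 n2 p)"
    by (rule mono_onI) (auto intro: EO_upper_mono n p)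
  show "antimono_on {0<..} (EO_lower n1 n2 p)"
    unfolding lower by (rule monotone_onI) (use EO_upper_mono[OF n p_minus] in auto)
  show "(EO_upper n1 n2 p \<longlongrightarrow> p) (at_right 0)"
    by (rule EO_upper_tendsto_at_right_0[OF n p])
  show "(EO_lower n1 n2 p \<longlongrightarrow> p) (at_right 0)"
    unfolding lower using tendsto_minus[OF EO_upper_tendsto_at_right_0[OF n p_minus]] by simp
  show "(EO_upper n1 n2 p \<longlongrightarrow> 1) at_top"
    by (rule EO_upper_tendsto_at_top[OF n p])
  show "(EO_lower n1 n2 p \<longlongrightarrow> -1) at_top"
    unfolding lower by (rule tendsto_minus[OF EO_upper_tendsto_at_top[OF n p_minus]])
  fix z :: real
  note interval = EO_interval_eq_differences[OF n p, of z]
  show "EO_lower n1 n2 p z \<le> p"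
    by (rule EO_lower_le[OF n p])
  show "p \<le> EO_upper n1 n2 p z"
    by (rule EO_upper_ge[OF n p])
  show "EO_interval n1 n2 p z \<subseteq> {-1..1}"
    using EO_upper_le_1[OF n p, of z] EO_lower_ge_minus_1[OF n p, of z]
    by (auto simp: EO_interval_def)
  show "Omega_square n1 n2 p z \<subseteq> {0..1} \<times> {0..1}"
    by (auto simp: Omega_square_slack)
  show "\<exists>(p1, p2)\<in>Omega_square n1 n2 p z. p1 - p2 = EO_lower n1 n2 p z"
    using EO_lower_attained(1)[OF n p, of z] by (simp add: split_beta)
  show "\<exists>(p1, p2)\<in>Omega_square n1 n2 p z. p1 - p2 = EO_upper n1 n2 p z"
    using EO_upper_attained(1)[OF n p, of z] by (simp add: split_beta)
  show "p = 1" if "1 \<in> EO_interval n1 n2 p z"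
    using one_in_EO_interval[OF n p that] .
  show "p = -1" if "-1 \<in> EO_interval n1 n2 p z"
    using minus_one_in_EO_interval[OF n p that] .
  show "EO_upper n1 n2 p z = 1" if "p = 1"
    using EO_upper_ge[OF n p, of z] EO_upper_le_1[OF n p, of z] that by simp
  show "EO_lower n1 n2 p z = -1" if "p = -1"
    using EO_lower_le[OF n p, of z] EO_lower_ge_minus_1[OF n p, of z] that by simp
  show "case x of (p1, p2) \<Rightarrow> p1 - p2 \<in> EO_interval n1 n2 p z"
    if "x \<in> Omega_square n1 n2 p z" for x
    using that by (auto simp: interval split_beta)
  show "\<exists>(p1, p2)\<in>Omega_square n1 n2 p z. p1 - p2 = d"
    if "d \<in> EO_interval n1 n2 p z" for d
    using that by (auto simp: interval split_beta)
qed

end
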